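(* Let $X=X_{d_1,\dots,d_c}\subset \mathbb{P}(a_0,\dots,a_n)$ be a quasismooth weighted complete intersection of amplitude $\alpha=\sum_{j=1}^c d_j-\sum_{i=0}^n a_i$ and codimension $c$ (so $\dim X=n-c$), which is not an intersection with a linear cone. Then $$c\le\begin{cases} \dim X+\alpha+1 & \text{if } \alpha \ge 0, \\ \dim X & \text{if } \alpha < 0.\end{cases}$$
   Context: Work over $\mathbb{C}$. For positive integers $a_0,\dots,a_n$, the weighted projective space $\mathbb{P}=\mathbb{P}(a_0,\dots,a_n)$ is $\mathrm{Proj}\,\mathbb{C}[x_0,\dots,x_n]$ with $\deg x_i=a_i$; $\pi:\mathbb{C}^{n+1}\setminus\{0\}\to\mathbb{P}$ is the natural quotient map. $\mathbb{P}$ is assumed well formed: $\gcd(a_0,\dots,\widehat{a_i},\dots,a_n)=1$ for every $i$. A weighted complete intersection $X=X_{d_1,\dots,d_c}\subset\mathbb{P}$ is the subvariety $(f_1=\dots=f_c=0)$, of codimension $c$, where $f_1,\dots,f_c$ are general homogeneous (with respect to the weights) polynomials of positive degrees $d_1,\dots,d_c$. $X$ is quasismooth if its affine cone $C_X=\pi^{-1}(X)$ is smooth away from $0$ (equivalently, the Jacobian matrix $(\partial f_j/\partial x_i)$ has rank $c$ at every point of $\pi^{-1}(X)$). $X$ is "not an intersection with a linear cone" if $d_j\ne a_i$ for all $i,j$. *)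

theory Defs
  imports
    "HOL-Library.Poly_Mapping"
    "HOL-Analysis.Abstract_Topology"
    "Jordan_Normal_Form.DL_Rank"
begin

section \<open>Complex polynomials\<close>

text \<open>A monomial is a finitely supported exponent function, a polynomial a finitely supported
  function from monomials to coefficients.\<close>

type_synonym 'v cpoly = "('v \<Rightarrow>\<^sub>0 nat) \<Rightarrow>\<^sub>0 complex"

definition eval_poly :: "('v \<Rightarrow> complex) \<Rightarrow> 'v cpoly \<Rightarrow> complex" where
  "eval_poly x f =
     (\<Sum>m\<in>Poly_Mapping.keys f.
        Poly_Mapping.lookup f m * (\<Prod>v\<in>Poly_Mapping.keys m. x v ^ Poly_Mapping.lookup m v))"

text \<open>In a term with exponent 0 at \<^term>\<open>v\<close> the truncated subtraction is harmless, because the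
  coefficient vanishes.\<close>

definition partial_deriv :: "'v \<Rightarrow> 'v cpoly \<Rightarrow> 'v cpoly" where
  "partial_deriv v f =
     (\<Sum>m\<in>Poly_Mapping.keys f.
        Poly_Mapping.single (m - Poly_Mapping.single v 1)
          (of_nat (Poly_Mapping.lookup m v) * Poly_Mapping.lookup f m))"

text \<open>\<^term>\<open>whom n a d\<close> is the degree \<^term>\<open>d\<close> part of the polynomial ring in the variables
  \<open>x\<^sub>0, \<dots>, x\<^sub>n\<close> with \<open>deg x\<^sub>i = a\<^sub>i\<close>; it contains the zero polynomial.\<close>

definition whom :: "nat \<Rightarrow> (nat \<Rightarrow> nat) \<Rightarrow> nat \<Rightarrow> nat cpoly set" where
  "whom n a d =
     {f. \<forall>m\<in>Poly_Mapping.keys f.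
           Poly_Mapping.keys m \<subseteq> {..n} \<and> (\<Sum>i\<le>n. a i * Poly_Mapping.lookup m i) = d}"


section \<open>Krull dimension of a topological space\<close>

definition irreducible_closed_in :: "'a topology \<Rightarrow> 'a set \<Rightarrow> bool" where
  "irreducible_closed_in T Z \<longleftrightarrow>
     closedin T Z \<and> Z \<noteq> {} \<and>
     (\<forall>A B. closedin T A \<and> closedin T B \<and> Z = A \<union> B \<longrightarrow> Z = A \<or> Z = B)"

definition irreducible_chain :: "'a topology \<Rightarrow> nat \<Rightarrow> (nat \<Rightarrow> 'a set) \<Rightarrow> bool" where
  "irreducible_chain T k Z \<longleftrightarrow>
     (\<forall>i\<le>k. irreducible_closed_in T (Z i)) \<and> (\<forall>i<k. Z i \<subset> Z (Suc i))"

text \<open>The empty space has no dimension in this sense.\<close>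

definition has_krull_dim :: "'a topology \<Rightarrow> nat \<Rightarrow> bool" where
  "has_krull_dim T k \<longleftrightarrow>
     (\<exists>Z. irreducible_chain T k Z) \<and> (\<forall>l>k. \<nexists>Z. irreducible_chain T l Z)"


section \<open>Weighted projective space\<close>

definition punctured_space :: "nat \<Rightarrow> complex vec set" where
  "punctured_space n = carrier_vec (n + 1) - {0\<^sub>v (n + 1)}"

definition weighted_rel :: "nat \<Rightarrow> (nat \<Rightarrow> nat) \<Rightarrow> (complex vec \<times> complex vec) set" where
  "weighted_rel n a =
     {(x, y). x \<in> punctured_space n \<and> y \<in> punctured_space n \<and>
        (\<exists>t. t \<noteq> 0 \<and> (\<forall>i\<le>n. y $ i = t ^ a i * x $ i))}"

definition wps :: "nat \<Rightarrow> (nat \<Rightarrow> nat) \<Rightarrow> complex vec set set" where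
  "wps n a = punctured_space n // weighted_rel n a"

definition wps_proj :: "nat \<Rightarrow> (nat \<Rightarrow> nat) \<Rightarrow> complex vec \<Rightarrow> complex vec set" where
  "wps_proj n a x = weighted_rel n a `` {x}"

definition well_formed :: "nat \<Rightarrow> (nat \<Rightarrow> nat) \<Rightarrow> bool" where
  "well_formed n a \<longleftrightarrow> (\<forall>i\<le>n. Gcd (a ` ({..n} - {i})) = 1)"

text \<open>The Zariski topology on the closed points of Proj, with the nonvanishing loci of weighted
  homogeneous polynomials (including the constant 1) as basic open sets.\<close>

definition zariski_wps :: "nat \<Rightarrow> (nat \<Rightarrow> nat) \<Rightarrow> complex vec set topology" where
  "zariski_wps n a =
     topology_generated_by
       {wps_proj n a ` {x \<in> punctured_space n. eval_poly (($) x) g \<noteq> 0} | g d. g \<in> whom n a d}"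


lemma one_in_whom: "(1 :: nat cpoly) \<in> whom n a 0"
  by (simp add: whom_def)

lemma eval_poly_one [simp]: "eval_poly x 1 = 1"
  by (simp add: eval_poly_def)

lemma topspace_zariski_wps: "topspace (zariski_wps n a) = wps n a"
proof -
  have "wps n a = wps_proj n a ` {x \<in> punctured_space n. eval_poly (($) x) 1 \<noteq> 0}"
    by (auto simp: wps_def quotient_def wps_proj_def)
  moreover have "wps_proj n a ` {x \<in> punctured_space n. eval_poly (($) x) g \<noteq> 0} \<subseteq> wps n a" for g
    by (auto simp: wps_def quotient_def wps_proj_def)
  ultimately show ?thesis
    using one_in_whom[of n a] unfolding zariski_wps_def topology_generated_by_topspace by blast
qed


section \<open>Weighted complete intersections\<close>

text \<open>The equations \<open>f\<^sub>1, \<dots>, f\<^sub>c\<close> and their degrees are indexed by \<^term>\<open>{..<c}\<close>.\<close>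

definition wci_equations ::
    "nat \<Rightarrow> (nat \<Rightarrow> nat) \<Rightarrow> nat \<Rightarrow> (nat \<Rightarrow> nat) \<Rightarrow> (nat \<Rightarrow> nat cpoly) set" where
  "wci_equations n a c d = (\<Pi>\<^sub>E j\<in>{..<c}. whom n a (d j))"

definition wci_locus ::
    "nat \<Rightarrow> (nat \<Rightarrow> nat) \<Rightarrow> nat \<Rightarrow> (nat \<Rightarrow> nat cpoly) \<Rightarrow> complex vec set set" where
  "wci_locus n a c f =
     wps_proj n a ` {x \<in> punctured_space n. \<forall>j<c. eval_poly (($) x) (f j) = 0}"

definition has_codim ::
    "nat \<Rightarrow> (nat \<Rightarrow> nat) \<Rightarrow> complex vec set set \<Rightarrow> nat \<Rightarrow> bool" where
  "has_codim n a X c \<longleftrightarrow> c \<le> n \<and> has_krull_dim (subtopology (zariski_wps n a) X) (n - c)"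

definition jacobian :: "nat \<Rightarrow> nat \<Rightarrow> (nat \<Rightarrow> nat cpoly) \<Rightarrow> complex vec \<Rightarrow> complex mat" where
  "jacobian n c f x =
     mat c (n + 1) (\<lambda>(j, i). eval_poly (($) x) (partial_deriv i (f j)))"

text \<open>The points \<^term>\<open>x\<close> below are those of the affine cone over the locus, away from the origin.\<close>

definition quasismooth ::
    "nat \<Rightarrow> (nat \<Rightarrow> nat) \<Rightarrow> nat \<Rightarrow> (nat \<Rightarrow> nat cpoly) \<Rightarrow> bool" where
  "quasismooth n a c f \<longleftrightarrow>
     (\<forall>x\<in>punctured_space n.
        wps_proj n a x \<in> wci_locus n a c f \<longrightarrow> vec_space.rank c (jacobian n c f x) = c)"

definition quasismooth_wci ::
    "nat \<Rightarrow> (nat \<Rightarrow> nat) \<Rightarrow> nat \<Rightarrow> (nat \<Rightarrow> nat cpoly) \<Rightarrow> bool" where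
  "quasismooth_wci n a c f \<longleftrightarrow> has_codim n a (wci_locus n a c f) c \<and> quasismooth n a c f"


section \<open>General equations\<close>

text \<open>The Zariski topology on the space of all tuples of equations, generated by the nonvanishing
  loci of the polynomials \<^term>\<open>F\<close> in the coefficients; the variable \<^term>\<open>(j, m)\<close> stands for the
  coefficient of the monomial \<^term>\<open>m\<close> in the equation number \<^term>\<open>j\<close>.\<close>

definition zariski_equations ::
    "nat \<Rightarrow> (nat \<Rightarrow> nat) \<Rightarrow> nat \<Rightarrow> (nat \<Rightarrow> nat) \<Rightarrow> (nat \<Rightarrow> nat cpoly) topology" where
  "zariski_equations n a c d =
     topology_generated_by
       {{f \<in> wci_equations n a c d. eval_poly (\<lambda>(j, m). Poly_Mapping.lookup (f j) m) F \<noteq> 0} | F.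
          True}"

lemma topspace_zariski_equations:
  "topspace (zariski_equations n a c d) = wci_equations n a c d"
proof -
  have "wci_equations n a c d =
      {f \<in> wci_equations n a c d. eval_poly (\<lambda>(j, m). Poly_Mapping.lookup (f j) m) 1 \<noteq> 0}"
    by simp
  then show ?thesis
    unfolding zariski_equations_def topology_generated_by_topspace by blast
qed

text \<open>A property holds for general equations if it holds on a nonempty Zariski open set; the space
  of equations is an affine space, hence irreducible, so that such a set is dense.\<close>

definition for_general_equations ::
    "nat \<Rightarrow> (nat \<Rightarrow> nat) \<Rightarrow> nat \<Rightarrow> (nat \<Rightarrow> nat) \<Rightarrow> ((nat \<Rightarrow> nat cpoly) \<Rightarrow> bool) \<Rightarrow> bool" where
  "for_general_equations n a c d P \<longleftrightarrow>
     (\<exists>U. openin (zariski_equations n a c d) U \<and> U \<noteq> {} \<and> (\<forall>f\<in>U. P f))"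

definition amplitude :: "nat \<Rightarrow> (nat \<Rightarrow> nat) \<Rightarrow> nat \<Rightarrow> (nat \<Rightarrow> nat) \<Rightarrow> int" where
  "amplitude n a c d = (\<Sum>j<c. int (d j)) - (\<Sum>i\<le>n. int (a i))"

end

(*
  If 2 c <= n the bound is clear, so only alpha >= 2 c - n - 1 for n + 1 <= 2 c has to be shown, and
  for this a single quasismooth system of equations is enough.  Order the variables by decreasing
  weights b_0 >= b_1 >= ..., and let R_k be the set of those equations that do not vanish identically
  on the coordinate subspace of the first k variables.  For the smallest k with card R_k < k, one has
  card R_k = k - 1, and the equations of R_k can be matched with the variables 0, ..., k - 2 such that
  an equation matched with i contains a monomial in the variables 0, ..., i; since no equation has the
  degree of a variable, its degree is at least 2 b_i.  The k - 1 equations of R_k have a common zero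
  z <> 0 in the subspace of dimension k, where the others vanish anyway.  By quasismoothness the
  Jacobian matrix at z has a nonzero transversal.  If it assigns the variable v to an equation outside
  R_k, then v is not among the first k variables and the equation has a monomial x_v * m with m
  nonconstant in the first k variables, so that its degree is at least a_v + b_(k - 1).  Adding up
  these estimates gives alpha >= (2 c - n - 1) b_(k - 1).

  That fewer weighted homogeneous forms than variables have a nontrivial common zero is reduced to
  the Nullstellensatz.  If a power of every variable were in the ideal of the forms, then each
  monomial would be a combination of products of the forms with monomials of bounded exponents, and
  there are too few such products.  The Nullstellensatz is the argument for uncountable fields: the
  functions 1 / (X - mu), for mu complex, cannot be independent in a space of countable dimension.
*)
theory Submission
  imports
    Defs
    "HOL-Analysis.Continuum_Not_Denumerable"
    "HOL-Computational_Algebra.Fundamental_Theorem_Algebra"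
begin

section \<open>Evaluation and truncation of polynomials\<close>

abbreviation keys :: "('a \<Rightarrow>\<^sub>0 'b::zero) \<Rightarrow> 'a set" where
  "keys \<equiv> Poly_Mapping.keys"

abbreviation lookup :: "('a \<Rightarrow>\<^sub>0 'b::zero) \<Rightarrow> 'a \<Rightarrow> 'b" where
  "lookup \<equiv> Poly_Mapping.lookup"

abbreviation single :: "'a \<Rightarrow> 'b \<Rightarrow> 'a \<Rightarrow>\<^sub>0 'b::zero" where
  "single \<equiv> Poly_Mapping.single"

lemma poly_mapping_sum_single: "(\<Sum>m\<in>keys f. single m (lookup f m)) = f"
  by (rule poly_mapping_eqI) (simp add: lookup_sum lookup_single when_def in_keys_iff)

lemma poly_mapping_add_induct [case_names single add]:
  fixes f :: "'a \<Rightarrow>\<^sub>0 'b::comm_monoid_add"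
  assumes single: "\<And>m c. P (single m c)"
    and add: "\<And>f g. P f \<Longrightarrow> P g \<Longrightarrow> P (f + g)"
  shows "P f"
proof -
  have "P (\<Sum>m\<in>A. single m (lookup f m))" if "finite A" for A
    using that
  proof (induction A)
    case empty
    \<comment> \<open>The zero mapping is a term with coefficient 0, so the rule can do without a
      base case for 0.\<close>
    then show ?case using single[of undefined 0] by simp
  next
    case (insert x A)
    then show ?case by (simp add: single add)
  qed
  from this[of "keys f"] show ?thesis by (simp add: poly_mapping_sum_single)
qed

lemma keys_add_nat: "keys (m + m') = keys m \<union> keys m'" for m m' :: "'a \<Rightarrow>\<^sub>0 nat"
  by (auto simp: in_keys_iff lookup_add)

section \<open>Evaluation of monomials and polynomials\<close>

definition eval_monomial :: "('v \<Rightarrow> complex) \<Rightarrow> ('v \<Rightarrow>\<^sub>0 nat) \<Rightarrow> complex" where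
  "eval_monomial x m = (\<Prod>v\<in>keys m. x v ^ lookup m v)"

lemma eval_monomial_superset:
  assumes "finite A" "keys m \<subseteq> A"
  shows "eval_monomial x m = (\<Prod>v\<in>A. x v ^ lookup m v)"
  unfolding eval_monomial_def using assms
  by (intro prod.mono_neutral_left) (auto simp: in_keys_iff)

lemma eval_monomial_add: "eval_monomial x (m + m') = eval_monomial x m * eval_monomial x m'"
proof -
  have "eval_monomial x k = (\<Prod>v\<in>keys m \<union> keys m'. x v ^ lookup k v)"
    if "keys k \<subseteq> keys m \<union> keys m'" for k
    using that by (intro eval_monomial_superset) auto
  from this[of "m + m'"] this[of m] this[of m'] show ?thesis
    by (simp add: keys_add_nat lookup_add power_add prod.distrib)
qed

lemma eval_poly_altdef: "eval_poly x f = (\<Sum>m\<in>keys f. lookup f m * eval_monomial x m)"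
  by (simp add: eval_poly_def eval_monomial_def)

lemma eval_poly_single [simp]: "eval_poly x (single m c) = c * eval_monomial x m"
  by (simp add: eval_poly_altdef)

lemma eval_poly_add [simp]: "eval_poly x (f + g) = eval_poly x f + eval_poly x g"
  unfolding eval_poly_altdef by (rule setsum_keys_plus_distrib) (auto simp: algebra_simps)

lemma eval_poly_0 [simp]: "eval_poly x 0 = 0"
  by (simp add: eval_poly_def)

lemma eval_poly_sum: "eval_poly x (sum f A) = (\<Sum>a\<in>A. eval_poly x (f a))"
  by (induction A rule: infinite_finite_induct) auto

lemma eval_poly_mult [simp]: "eval_poly x (f * g) = eval_poly x f * eval_poly x g"
proof (induction f rule: poly_mapping_add_induct)
  case (single m c)
  show ?case
    by (induction g rule: poly_mapping_add_induct)
      (simp_all add: mult_single eval_monomial_add algebra_simps)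
qed (simp_all add: algebra_simps)

text \<open>Serves two purposes: taking a homogeneous component, and restricting an equation to a
  coordinate subspace.\<close>

definition poly_filter :: "('a \<Rightarrow> bool) \<Rightarrow> ('a \<Rightarrow>\<^sub>0 'b::comm_monoid_add) \<Rightarrow> 'a \<Rightarrow>\<^sub>0 'b" where
  "poly_filter P f = (\<Sum>m\<in>{m \<in> keys f. P m}. single m (lookup f m))"

lemma lookup_poly_filter: "lookup (poly_filter P f) m = (if P m then lookup f m else 0)"
proof -
  have "lookup (poly_filter P f) m
      = (\<Sum>k\<in>{m \<in> keys f. P m}. if k = m then lookup f k else 0)"
    unfolding poly_filter_def lookup_sum by (intro sum.cong) (auto simp: lookup_single when_def)
  also have "\<dots> = (if P m then lookup f m else 0)"
    by (subst sum.delta) (auto simp: in_keys_iff)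
  finally show ?thesis .
qed

lemma keys_poly_filter: "keys (poly_filter P f) = {m \<in> keys f. P m}"
  by (auto simp: in_keys_iff lookup_poly_filter split: if_splits)

lemma poly_filter_add: "poly_filter P (f + g) = poly_filter P f + poly_filter P g"
  by (rule poly_mapping_eqI) (simp add: lookup_poly_filter lookup_add)

lemma poly_filter_0 [simp]: "poly_filter P 0 = 0"
  by (rule poly_mapping_eqI) (simp add: lookup_poly_filter)

lemma poly_filter_sum: "poly_filter P (sum f A) = (\<Sum>a\<in>A. poly_filter P (f a))"
  by (induction A rule: infinite_finite_induct) (auto simp: poly_filter_add)

lemma poly_filter_single: "poly_filter P (single m c) = (if P m then single m c else 0)"
  by (rule poly_mapping_eqI) (auto simp: lookup_poly_filter lookup_single when_def)

text \<open>Both sides are linear in \<open>q\<close> and in \<open>f\<close>, so comparing single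
  terms suffices. For homogeneous \<open>f\<close> it says that a homogeneous component of
  \<open>q * f\<close> only sees one component of \<open>q\<close>.\<close>

lemma poly_filter_mult:
  fixes f q :: "'a::cancel_comm_monoid_add \<Rightarrow>\<^sub>0 'b::comm_semiring_1"
  assumes "\<And>m m'. m' \<in> keys f \<Longrightarrow> P (m + m') \<longleftrightarrow> Q m"
  shows "poly_filter P (q * f) = poly_filter Q q * f"
proof -
  have "poly_filter P (q * single m' c) = poly_filter Q q * single m' c"
    if "m' \<in> keys f" for m' c
    by (induction q rule: poly_mapping_add_induct)
      (auto simp: mult_single poly_filter_single poly_filter_add algebra_simps assms that)
  then have "poly_filter P (q * (\<Sum>m\<in>keys f. single m (lookup f m)))
      = poly_filter Q q * (\<Sum>m\<in>keys f. single m (lookup f m))"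
    by (simp add: sum_distrib_left poly_filter_sum)
  then show ?thesis
    by (simp add: poly_mapping_sum_single)
qed

section \<open>The Nullstellensatz\<close>

text \<open>The ring as a module over itself: \<open>subspace\<close> now means ideal and
  \<open>span\<close> means generated ideal.\<close>

interpretation ring_ideal: Modules.module "(*) :: 'a::comm_ring_1 \<Rightarrow> 'a \<Rightarrow> 'a"
  by unfold_locales (auto simp: algebra_simps)

interpretation cpoly_space: Vector_Spaces.vector_space "\<lambda>c (p :: 'v cpoly). single 0 c * p"
  by unfold_locales (simp_all add: ring_distribs single_add mult_single mult.assoc[symmetric])

text \<open>These simplification rules do not terminate together with associativity of multiplication.\<close>
declare ring_ideal.scale_scale [simp del] cpoly_space.scale_scale [simp del]

lemma single_in_cpoly_span:
  "m \<in> B \<Longrightarrow> single m c \<in> cpoly_space.span ((\<lambda>m. single m 1) ` B)"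
  using cpoly_space.span_scale[OF cpoly_space.span_base[of "single m 1" "(\<lambda>m. single m 1) ` B"], of c]
  by (simp add: mult_single)

lemma cpoly_in_span_keys:
  assumes "keys f \<subseteq> B"
  shows "f \<in> cpoly_space.span ((\<lambda>m. single m 1) ` B)"
proof -
  have "(\<Sum>m\<in>keys f. single m (lookup f m)) \<in> cpoly_space.span ((\<lambda>m. single m 1) ` B)"
    using assms by (intro cpoly_space.span_sum single_in_cpoly_span) auto
  then show ?thesis by (simp add: poly_mapping_sum_single)
qed

text \<open>Zorn's lemma. By maximality the ideal generated by \<open>J\<close> and some
  \<open>t\<close> outside \<open>J\<close> contains a power of \<open>s\<close>; the last
  conclusion thus says that \<open>t\<close> divides a power of \<open>s\<close> modulo
  \<open>J\<close>.\<close>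

lemma ideal_maximal_avoiding_powers:
  fixes s :: "'a::comm_ring_1"
  assumes J0: "ring_ideal.subspace J0" "\<And>N. s ^ N \<notin> J0"
  obtains J where "J0 \<subseteq> J" "ring_ideal.subspace J" "\<And>N. s ^ N \<notin> J"
    "\<And>t. t \<notin> J \<Longrightarrow> \<exists>N h. s ^ N - h * t \<in> J"
proof -
  let ?A = "{J. J0 \<subseteq> J \<and> ring_ideal.subspace J \<and> (\<forall>N. s ^ N \<notin> J)}"
  have "\<exists>M\<in>?A. \<forall>X\<in>?A. M \<subseteq> X \<longrightarrow> X = M"
  proof (rule subset_Zorn_nonempty)
    fix C assume C: "C \<noteq> {}" "subset.chain ?A C"
    then have sub: "C \<subseteq> ?A" and lin: "\<And>X Y. X \<in> C \<Longrightarrow> Y \<in> C \<Longrightarrow> X \<subseteq> Y \<or> Y \<subseteq> X"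
      by (auto simp: subset_chain_def)
    have "ring_ideal.subspace (\<Union>C)"
    proof (rule ring_ideal.subspaceI)
      show "0 \<in> \<Union>C" using C sub by (auto dest: ring_ideal.subspace_0)
    next
      fix x y assume "x \<in> \<Union>C" "y \<in> \<Union>C"
      then obtain X Y where "x \<in> X" "X \<in> C" "y \<in> Y" "Y \<in> C" by blast
      with lin[of X Y] obtain Z where "Z \<in> C" "x \<in> Z" "y \<in> Z" by blast
      with sub show "x + y \<in> \<Union>C" by (blast intro: ring_ideal.subspace_add)
    next
      fix c x assume "x \<in> \<Union>C"
      with sub show "c * x \<in> \<Union>C" by (blast intro: ring_ideal.subspace_scale)
    qed
    with C sub show "\<Union>C \<in> ?A" by auto
  qed (use J0 in auto)
  then obtain J where J: "J \<in> ?A" and max: "\<forall>X\<in>?A. J \<subseteq> X \<longrightarrow> X = J"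
    by (rule bexE)
  show thesis
  proof (rule that[of J])
    fix t assume t: "t \<notin> J"
    let ?K = "ring_ideal.span (insert t J)"
    have "J \<subseteq> ?K" "t \<in> ?K" using ring_ideal.span_superset[of "insert t J"] by auto
    have "?K \<notin> ?A" 
    proof
      assume "?K \<in> ?A"
      then have "?K = J" using \<open>J \<subseteq> ?K\<close> by (rule max[rule_format])
      with \<open>t \<in> ?K\<close> t show False by metis
    qed
    moreover have "ring_ideal.subspace ?K" by simp
    ultimately obtain N where "s ^ N \<in> ?K" using J \<open>J \<subseteq> ?K\<close> by blast
    moreover have "ring_ideal.span J = J" using J by (simp only: ring_ideal.span_eq_iff) blast
    ultimately show "\<exists>N h. s ^ N - h * t \<in> J" by (auto simp: ring_ideal.span_insert)
  qed (use J in auto)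
qed

text \<open>An independent set in the span of \<open>B\<close> has at most \<open>card B\<close>
  elements. The relation is indexed by \<open>L\<close>, so a repeated value of \<open>h\<close>
  already gives one; hence the case distinction.\<close>

lemma (in Vector_Spaces.vector_space) infinite_family_dependent:
  assumes "infinite L" "finite B" "h ` L \<subseteq> span B"
  obtains T c where "finite T" "T \<subseteq> L" "(\<Sum>l\<in>T. c l *s h l) = 0" "\<exists>l\<in>T. c l \<noteq> 0"
proof (cases "inj_on h L")
  case True
  then have "infinite (h ` L)" using assms(1) finite_image_iff by blast
  with assms independent_span_bound[of B "h ` L"] have "dependent (h ` L)" by blast
  then obtain S u where S: "finite S" "S \<subseteq> h ` L" "(\<Sum>v\<in>S. u v *s v) = 0" "\<exists>v\<in>S. u v \<noteq> 0"
    by (auto simp: dependent_explicit)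
  then obtain T where T: "T \<subseteq> L" "S = h ` T" by (auto simp: subset_image_iff)
  with True have "inj_on h T" by (blast intro: inj_on_subset)
  with S T show ?thesis
    by (intro that[of T "u \<circ> h"]) (auto simp: sum.reindex finite_image_iff)
next
  case False
  then obtain x y where "x \<in> L" "y \<in> L" "x \<noteq> y" "h x = h y" by (auto simp: inj_on_def)
  then show ?thesis
    by (intro that[of "{x, y}" "\<lambda>l. if l = x then 1 else - 1"]) auto
qed

section \<open>Countability of the exponents and of their finite sets\<close>

lemma countable_exponents: "countable (UNIV :: ('v::countable \<Rightarrow>\<^sub>0 nat) set)"
proof -
  let ?g = "\<lambda>m::'v \<Rightarrow>\<^sub>0 nat. (\<lambda>v. (v, lookup m v)) ` keys m"
  have "lookup m v = n \<longleftrightarrow> (if n = 0 then \<forall>k. (v, k) \<notin> ?g m else (v, n) \<in> ?g m)" for m v n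
    by (auto simp: in_keys_iff image_iff)
  then have "inj ?g" by (intro injI poly_mapping_eqI) metis
  moreover have "countable (range ?g)"
    by (rule countable_subset[OF _ countable_Collect_finite]) auto
  ultimately show ?thesis by (rule countable_image_inj_on[rotated])
qed

text \<open>Otherwise the complex numbers would be a countable union of finite sets.\<close>

lemma infinite_fibre_of_countable_range:
  fixes f :: "complex \<Rightarrow> 'b"
  assumes "countable (range f)"
  shows "\<exists>p. infinite {z. f z = p}"
proof (rule ccontr)
  assume "\<not> ?thesis"
  with assms have "countable (\<Union>p\<in>range f. {z. f z = p})"
    by (intro countable_UN) (auto intro: countable_finite)
  moreover have "(\<Union>p\<in>range f. {z. f z = p}) = UNIV" by auto
  ultimately show False using uncountable_UNIV_complex by simp
qed

lemma countable_finite_exponent_sets: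
  "countable (Collect finite :: ('v::countable \<Rightarrow>\<^sub>0 nat) set set)"
  using countable_Collect_finite_subset[OF countable_exponents] by simp

abbreviation cvar :: "'v \<Rightarrow> 'v cpoly" where
  "cvar v \<equiv> single (single v 1) 1"

text \<open>Modulo \<open>J\<close> every variable is congruent to a scalar. The polynomials
  congruent to their value at \<open>x\<close> are closed under sums and products, and contain the
  constants and the variables.\<close>

lemma subspace_eval_kernel:
  fixes J :: "'v cpoly set"
  assumes J: "ring_ideal.subspace J" and x: "\<And>v. cvar v - single 0 (x v) \<in> J"
  shows "f - single 0 (eval_poly x f) \<in> J"
proof -
  define P where "P f \<longleftrightarrow> f - single 0 (eval_poly x f) \<in> J" for f
  have add: "P (f + g)" if "P f" "P g" for f g
  proof -
    have "f + g - single 0 (eval_poly x (f + g))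
        = (f - single 0 (eval_poly x f)) + (g - single 0 (eval_poly x g))"
      by (simp add: single_add)
    with that show ?thesis
      unfolding P_def using ring_ideal.subspace_add[OF J] by metis
  qed
  have mult: "P (f * g)" if "P f" "P g" for f g
  proof -
    have "f * g - single 0 (eval_poly x (f * g))
        = f * (g - single 0 (eval_poly x g)) + single 0 (eval_poly x g) * (f - single 0 (eval_poly x f))"
      by (simp add: algebra_simps mult_single)
    with that show ?thesis
      unfolding P_def
      using ring_ideal.subspace_add[OF J] ring_ideal.subspace_scale[OF J] by metis
  qed
  have const: "P (single 0 c)" for c
    using ring_ideal.subspace_0[OF J] by (simp add: P_def eval_monomial_def)
  have var: "P (cvar v)" for v
    using x[of v] by (simp add: P_def eval_monomial_def)
  have "P (single m 1)" for m
  \<comment> \<open>The exponent is itself a finitely supported function; adding exponents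
    multiplies monomials.\<close>
  proof (induction m rule: poly_mapping_add_induct)
    case (single v k)
    show ?case
    proof (induction k)
      case 0
      then show ?case using const[of 1] by simp
    next
      case (Suc k)
      have "single (single v (Suc k)) 1 = cvar v * single (single v k) (1::complex)"
        by (simp add: mult_single flip: single_add)
      with mult[OF var Suc] show ?case by metis
    qed
  next
    case (add m m')
    then show ?case using mult[of "single m 1" "single m' 1"] by (simp add: mult_single)
  qed
  then have "P (single m c)" for m c
    using mult[OF const[of c], of "single m 1"] by (simp add: mult_single)
  then have "P f"
    by (induction f rule: poly_mapping_add_induct) (simp_all add: add)
  then show ?thesis by (simp add: P_def)
qed

text \<open>The homomorphism from one-variable polynomials that sends the variable to
  \<open>X\<close>; it expresses algebraic equations for \<open>X\<close> modulo an ideal.\<close>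

definition cpoly_subst :: "'v cpoly \<Rightarrow> complex poly \<Rightarrow> 'v cpoly" where
  "cpoly_subst X q = poly (map_poly (single 0) q) X"

lemma cpoly_subst_pCons [simp]: "cpoly_subst X (pCons a q) = single 0 a + X * cpoly_subst X q"
  unfolding cpoly_subst_def by (cases "pCons a q = 0") (auto simp: map_poly_pCons)

lemma cpoly_subst_0 [simp]: "cpoly_subst X 0 = 0"
  by (simp add: cpoly_subst_def)

lemma cpoly_subst_1 [simp]: "cpoly_subst X 1 = 1"
  unfolding one_pCons by simp

lemma cpoly_subst_add [simp]: "cpoly_subst X (p + q) = cpoly_subst X p + cpoly_subst X q"
  unfolding cpoly_subst_def poly_add[symmetric]
  by (rule arg_cong[where f = "\<lambda>p. poly p X"], rule poly_eqI)
    (simp add: coeff_map_poly single_add)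

lemma cpoly_subst_smult [simp]: "cpoly_subst X (Polynomial.smult c p)
    = single 0 c * cpoly_subst X p"
  unfolding cpoly_subst_def poly_smult[symmetric]
  by (rule arg_cong[where f = "\<lambda>p. poly p X"], rule poly_eqI)
    (simp add: coeff_map_poly mult_single)

lemma cpoly_subst_mult [simp]: "cpoly_subst X (p * q) = cpoly_subst X p * cpoly_subst X q"
  by (induction p) (simp_all add: algebra_simps)

lemma cpoly_subst_sum: "cpoly_subst X (sum f A) = (\<Sum>a\<in>A. cpoly_subst X (f a))"
  by (induction A rule: infinite_finite_induct) auto

lemma cpoly_subst_prod: "cpoly_subst X (prod f A) = (\<Prod>a\<in>A. cpoly_subst X (f a))"
  by (induction A rule: infinite_finite_induct) auto

text \<open>Over the complex numbers \<open>q\<close> splits into linear factors, and a prime ideal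
  contains one of them; the leading constant is a unit.\<close>

lemma ideal_contains_linear_factor:
  fixes X :: "'v cpoly"
  assumes J: "1 \<notin> J" "ring_ideal.subspace J"
    and prime: "\<And>t u. t * u \<in> J \<Longrightarrow> t \<in> J \<or> u \<in> J"
    and q: "q \<noteq> 0" "cpoly_subst X q \<in> J"
  shows "\<exists>\<mu>. X - single 0 \<mu> \<in> J"
  using q
proof (induction "degree q" arbitrary: q)
  case 0
  then obtain c where c: "q = [:c:]" "c \<noteq> 0" by (metis degree_eq_zeroE pCons_0_0)
  with 0 have "single 0 c \<in> J" by simp
  then have "single 0 (inverse c) * single 0 c \<in> J" using J ring_ideal.subspace_scale by blast
  with c J show ?case by (simp add: mult_single)
next
  case (Suc n)
  have "\<not> constant (poly q)" using Suc(2) by (simp add: constant_degree)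
  then obtain \<mu> where "poly q \<mu> = 0" using fundamental_theorem_of_algebra by blast
  then obtain r where r: "q = [:- \<mu>, 1:] * r" by (auto simp: poly_eq_0_iff_dvd)
  with Suc.prems have "r \<noteq> 0" by auto
  then have "degree q = 1 + degree r" unfolding r by (subst degree_mult_eq) auto
  with Suc(2) have "degree r = n" by simp
  have "cpoly_subst X q = (X - single 0 \<mu>) * cpoly_subst X r"
    unfolding r cpoly_subst_mult by (simp add: single_uminus)
  with Suc.prems prime consider "X - single 0 \<mu> \<in> J" | "cpoly_subst X r \<in> J"
    by metis
  then show ?case using Suc(1)[of r] \<open>r \<noteq> 0\<close> \<open>degree r = n\<close> by metis
qed

text \<open>If \<open>t\<close> and \<open>u\<close> were both outside \<open>J\<close>, each would
  divide a power of \<open>s\<close> modulo \<open>J\<close>, and so would their product, which lies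
  in \<open>J\<close>.\<close>

lemma prime_of_maximal_avoiding_powers:
  fixes s :: "'a::comm_ring_1"
  assumes J: "ring_ideal.subspace J" and s: "\<And>N. s ^ N \<notin> J"
    and max: "\<And>t. t \<notin> J \<Longrightarrow> \<exists>N h. s ^ N - h * t \<in> J" and tu: "t * u \<in> J"
  shows "t \<in> J \<or> u \<in> J"
proof (rule ccontr)
  assume "\<not> (t \<in> J \<or> u \<in> J)"
  then obtain N h M k where 1: "s ^ N - h * t \<in> J" and 2: "s ^ M - k * u \<in> J"
    using max by metis
  note add = ring_ideal.subspace_add[OF J] and scale = ring_ideal.subspace_scale[OF J]
  have "a * b = b * (a - h * t) + h * t * (b - k * u) + h * k * (t * u)" for a b :: 'a
    by (simp add: algebra_simps)
  then have "s ^ (N + M) = s ^ M * (s ^ N - h * t) + h * t * (s ^ M - k * u) + h * k * (t * u)"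
    unfolding power_add .
  also have "\<dots> \<in> J"
    by (rule add[OF add[OF scale[OF 1] scale[OF 2]] scale[OF tu]])
  finally show False using s by blast
qed

text \<open>For \<open>J\<close> maximal among the ideals avoiding the powers of \<open>s\<close>,
  each variable is congruent to a scalar modulo \<open>J\<close>, and these scalars are the
  coordinates of the zero.\<close>

lemma power_nullstellensatz:
  fixes F :: "('v::countable) cpoly set"
  assumes s: "\<And>N. s ^ N \<notin> ring_ideal.span F"
  obtains x where "eval_poly x s \<noteq> 0" "\<And>f. f \<in> F \<Longrightarrow> eval_poly x f = 0"
proof -
  obtain J where FJ: "ring_ideal.span F \<subseteq> J" and J: "ring_ideal.subspace J"
    and sJ: "\<And>N. s ^ N \<notin> J" and max: "\<And>t. t \<notin> J \<Longrightarrow> \<exists>N h. s ^ N - h * t \<in> J"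
    using ideal_maximal_avoiding_powers[OF ring_ideal.subspace_span s] by metis
  note J_scale = ring_ideal.subspace_scale[OF J] and J_diff = ring_ideal.subspace_diff[OF J]
  have J1: "1 \<notin> J" using sJ[of 0] by simp
  have prime: "t \<in> J \<or> u \<in> J" if "t * u \<in> J" for t u
    using prime_of_maximal_avoiding_powers[OF J sJ max that] .
  have "\<exists>\<mu>. X - single 0 \<mu> \<in> J" for X :: "'v cpoly"
  proof (rule ccontr)
    assume none: "\<not> (\<exists>\<mu>. X - single 0 \<mu> \<in> J)"
    then have "\<forall>\<mu>. \<exists>N h. s ^ N - h * (X - single 0 \<mu>) \<in> J" using max by blast
    \<comment> \<open>Once \<open>s\<close> is inverted, \<open>h \<mu> / s ^ N \<mu>\<close> is an
      inverse of \<open>X - \<mu>\<close> modulo \<open>J\<close>.\<close>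
    then obtain N h where Nh: "\<And>\<mu>. s ^ N \<mu> - h \<mu> * (X - single 0 \<mu>) \<in> J" by metis
    \<comment> \<open>This map has a countable range, so it is constant on an infinite set of scalars.\<close>
    let ?\<Phi> = "\<lambda>\<mu>. (N \<mu>, keys (h \<mu>))"
    have "countable (range ?\<Phi>)"
      by (rule countable_subset[of _ "UNIV \<times> Collect finite"])
        (auto intro!: countable_SIGMA countable_finite_exponent_sets)
    then have "\<exists>p. infinite {\<mu>. ?\<Phi> \<mu> = p}" by (rule infinite_fibre_of_countable_range)
    then obtain p where inf: "infinite {\<mu>. ?\<Phi> \<mu> = p}" by (rule exE)
    obtain n B where p: "p = (n, B)" by force
    have Phi: "N \<mu> = n" "keys (h \<mu>) = B" if "?\<Phi> \<mu> = p" for \<mu>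
      using that p by simp_all
    have "{\<mu>. ?\<Phi> \<mu> = p} \<noteq> {}" using inf by (metis finite.emptyI)
    then have "finite B" using Phi(2) finite_keys by fastforce
    have sub: "h ` {\<mu>. ?\<Phi> \<mu> = p} \<subseteq> cpoly_space.span ((\<lambda>m. single m 1) ` B)"
      using cpoly_in_span_keys Phi(2) by blast
    obtain T c where T: "finite T" "T \<subseteq> {\<mu>. ?\<Phi> \<mu> = p}"
      and dep: "(\<Sum>\<mu>\<in>T. single 0 (c \<mu>) * h \<mu>) = 0" and nz: "\<exists>\<mu>\<in>T. c \<mu> \<noteq> 0"
      by (rule cpoly_space.infinite_family_dependent[OF inf finite_imageI[OF \<open>finite B\<close>] sub])
    \<comment> \<open>The numerator of the sum of all \<open>c \<mu> / (X - \<mu>)\<close> over the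
      common denominator \<open>G T\<close>.\<close>
    define q where "q = (\<Sum>\<mu>\<in>T. Polynomial.smult (c \<mu>) (\<Prod>\<nu>\<in>T - {\<mu>}. [:- \<nu>, 1:]))"
    define G where "G S = (\<Prod>\<nu>\<in>S. X - single 0 \<nu>)" for S
    obtain \<mu>0 where \<mu>0: "\<mu>0 \<in> T" "c \<mu>0 \<noteq> 0" using nz by blast
    \<comment> \<open>At \<open>\<mu>0\<close> every other summand contains the factor for
      \<open>\<nu> = \<mu>0\<close>, so it vanishes.\<close>
    have "poly q \<mu>0 = (\<Sum>\<mu>\<in>T. if \<mu> = \<mu>0 then c \<mu> * (\<Prod>\<nu>\<in>T - {\<mu>}. \<mu>0 - \<nu>) else 0)"
      unfolding q_def poly_sum poly_smult poly_prod using T(1) \<mu>0(1)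
      by (intro sum.cong refl) auto
    also have "\<dots> = c \<mu>0 * (\<Prod>\<nu>\<in>T - {\<mu>0}. \<mu>0 - \<nu>)"
      using T(1) \<mu>0(1) by simp
    also have "\<dots> \<noteq> 0" using T(1) \<mu>0(2) by auto
    finally have "q \<noteq> 0" by auto
    have q_subst: "cpoly_subst X q = (\<Sum>\<mu>\<in>T. single 0 (c \<mu>) * G (T - {\<mu>}))"
      by (simp add: q_def G_def cpoly_subst_sum cpoly_subst_prod single_uminus)
    have G: "G T = (X - single 0 \<mu>) * G (T - {\<mu>})" if "\<mu> \<in> T" for \<mu>
      unfolding G_def using T(1) that by (rule prod.remove)
    \<comment> \<open>Subtracting the vanishing relation times \<open>G T\<close> turns each summand
      into a multiple of an element of \<open>J\<close>; since \<open>J\<close> is prime and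
      contains no power of \<open>s\<close>, the value of \<open>q\<close> lies in
      \<open>J\<close>.\<close>
    have "s ^ n * cpoly_subst X q = s ^ n * cpoly_subst X q - (\<Sum>\<mu>\<in>T. single 0 (c \<mu>) * h \<mu>) * G T"
      by (simp add: dep)
    also have "\<dots> = (\<Sum>\<mu>\<in>T. single 0 (c \<mu>) * G (T - {\<mu>}) * (s ^ N \<mu> - h \<mu> * (X - single 0 \<mu>)))"
      unfolding q_subst sum_distrib_left[of "s ^ n"] sum_distrib_right sum_subtractf[symmetric]
    proof (intro sum.cong refl)
      fix \<mu> assume \<mu>: "\<mu> \<in> T"
      then have "N \<mu> = n" using Phi(1) T(2) by blast
      then show "s ^ n * (single 0 (c \<mu>) * G (T - {\<mu>})) - single 0 (c \<mu>) * h \<mu> * G T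
          = single 0 (c \<mu>) * G (T - {\<mu>}) * (s ^ N \<mu> - h \<mu> * (X - single 0 \<mu>))"
        unfolding G[OF \<mu>] by (simp only: ring_distribs right_diff_distrib ac_simps)
    qed
    also have "\<dots> \<in> J" by (intro ring_ideal.subspace_sum[OF J] J_scale Nh)
    finally have "cpoly_subst X q \<in> J" using prime sJ by blast
    with ideal_contains_linear_factor[OF J1 J prime \<open>q \<noteq> 0\<close>] none show False by blast
  qed
  then have "\<forall>v. \<exists>\<mu>. cvar v - single 0 \<mu> \<in> J" by blast
  then obtain x where x: "\<And>v. cvar v - single 0 (x v) \<in> J" by metis
  \<comment> \<open>A nonzero scalar in \<open>J\<close> would be a unit, so \<open>J\<close> is
    exactly the ideal of the point \<open>x\<close>.\<close>
  have kernel: "f \<in> J \<longleftrightarrow> eval_poly x f = 0" for f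
  proof -
    have sub: "f - single 0 (eval_poly x f) \<in> J" using subspace_eval_kernel[OF J x] .
    show ?thesis
    proof
      assume "f \<in> J"
      from J_diff[OF this sub] have "single 0 (eval_poly x f) \<in> J" by simp
      then have "single 0 (inverse (eval_poly x f)) * single 0 (eval_poly x f) \<in> J"
          by (rule J_scale)
      with J1 show "eval_poly x f = 0" by (cases "eval_poly x f = 0") (auto simp: mult_single)
    qed (use sub in simp)
  qed
  show thesis
  proof (rule that[of x])
    show "eval_poly x s \<noteq> 0" using kernel sJ[of 1] by auto
    show "eval_poly x f = 0" if "f \<in> F" for f
      using kernel FJ that ring_ideal.span_base by blast
  qed
qed

section \<open>Common zeros of weighted homogeneous forms\<close>

text \<open>The combinations on the right form an ideal containing all \<open>F j\<close>.
  Coefficients are indexed by \<open>A\<close>, so repeated generators are allowed.\<close>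

lemma in_ideal_span_image:
  fixes F :: "'j \<Rightarrow> 'a::comm_ring_1"
  assumes "finite A" "x \<in> ring_ideal.span (F ` A)"
  obtains q where "x = (\<Sum>j\<in>A. q j * F j)"
proof -
  let ?S = "{\<Sum>j\<in>A. q j * F j | q. True}"
  have "ring_ideal.subspace ?S"
  proof (rule ring_ideal.subspaceI)
    show "0 \<in> ?S" by (auto intro!: exI[of _ "\<lambda>_. 0"])
  next
    fix x y assume "x \<in> ?S" "y \<in> ?S"
    then obtain q r where "x = (\<Sum>j\<in>A. q j * F j)" "y = (\<Sum>j\<in>A. r j * F j)" by blast
    then have "x + y = (\<Sum>j\<in>A. (q j + r j) * F j)" by (simp add: sum.distrib distrib_right)
    then show "x + y \<in> ?S" by (intro CollectI exI[of _ "\<lambda>j. q j + r j"] conjI TrueI)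
  next
    fix c x assume "x \<in> ?S"
    then obtain q where "x = (\<Sum>j\<in>A. q j * F j)" by blast
    then have "c * x = (\<Sum>j\<in>A. (c * q j) * F j)" by (simp add: sum_distrib_left mult.assoc)
    then show "c * x \<in> ?S" by (intro CollectI exI[of _ "\<lambda>j. c * q j"] conjI TrueI)
  qed
  moreover have "F ` A \<subseteq> ?S"
  proof
    fix y assume "y \<in> F ` A"
    then obtain k where k: "k \<in> A" "y = F k" by blast
    have "y = (\<Sum>j\<in>A. if j = k then F j else 0)" using k assms(1) by simp
    also have "\<dots> = (\<Sum>j\<in>A. (if j = k then 1 else 0) * F j)" by (intro sum.cong) auto
    finally show "y \<in> ?S"
      by (intro CollectI exI[of _ "\<lambda>j. if j = k then 1 else 0"] conjI TrueI)
  qed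
  ultimately have "ring_ideal.span (F ` A) \<subseteq> ?S" by (intro ring_ideal.span_minimal)
  with assms(2) that show thesis by blast
qed

lemma independent_monomials:
  "cpoly_space.independent ((\<lambda>m. single m (1::complex)) ` (B :: ('v \<Rightarrow>\<^sub>0 nat) set))"
  unfolding cpoly_space.independent_explicit_module
proof (intro allI impI)
  fix t and u :: "_ \<Rightarrow> complex" and p
  assume t: "finite t" "t \<subseteq> (\<lambda>m. single m (1::complex)) ` B"
    and sum0: "(\<Sum>v\<in>t. single 0 (u v) * v) = 0" and p: "p \<in> t"
  from t p obtain m where m: "p = single m 1" by blast
  have "0 = lookup (\<Sum>v\<in>t. single 0 (u v) * v) m" by (simp add: sum0)
  also have "\<dots> = (\<Sum>v\<in>t. if v = p then u v else 0)"
    unfolding lookup_sum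
  proof (intro sum.cong refl)
    fix v assume "v \<in> t"
    with t obtain m' where "v = single m' 1" by blast
    moreover have "single m (1::complex) = single m' 1 \<longleftrightarrow> m = m'"
      by (metis keys_single singleton_inject zero_neq_one)
    ultimately show "lookup (single 0 (u v) * v) m = (if v = p then u v else 0)"
      by (auto simp: m mult_single lookup_single when_def)
  qed
  also have "\<dots> = u p" using t p by simp
  finally show "u p = 0" by simp
qed

text \<open>For \<open>N > 0\<close>, the monomials in the variables \<open>I\<close> divisible by
  no \<open>N\<close>-th power of a variable.\<close>

definition exponents_below :: "'v set \<Rightarrow> nat \<Rightarrow> ('v \<Rightarrow>\<^sub>0 nat) set" where
  "exponents_below I N = {m. keys m \<subseteq> I \<and> (\<forall>i\<in>I. lookup m i < N)}"

lemma bij_betw_exponents_below: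
  assumes "finite I"
  shows "bij_betw (\<lambda>m. restrict (lookup m) I) (exponents_below I N) (I \<rightarrow>\<^sub>E {..<N})"
proof (rule bij_betw_imageI)
  show "inj_on (\<lambda>m. restrict (lookup m) I) (exponents_below I N)"
  proof (rule inj_onI, rule poly_mapping_eqI)
    fix m m' v
    assume "m \<in> exponents_below I N" "m' \<in> exponents_below I N"
      and eq: "restrict (lookup m) I = restrict (lookup m') I"
    then have "keys m \<subseteq> I" "keys m' \<subseteq> I" by (auto simp: exponents_below_def)
    with fun_cong[OF eq, of v] show "lookup m v = lookup m' v"
      by (cases "v \<in> I") (simp, metis in_keys_iff subsetD)
  qed
  show "(\<lambda>m. restrict (lookup m) I) ` exponents_below I N = (I \<rightarrow>\<^sub>E {..<N})"
  proof (intro equalityI subsetI)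
    fix g assume g: "g \<in> I \<rightarrow>\<^sub>E {..<N}"
    let ?m = "\<Sum>i\<in>I. single i (g i)"
    have lookup: "lookup ?m v = (if v \<in> I then g v else 0)" for v
      using assms by (simp add: lookup_sum lookup_single when_def)
    then have "keys ?m \<subseteq> I" by (auto simp: in_keys_iff split: if_splits)
    with g lookup have "?m \<in> exponents_below I N" by (auto simp: exponents_below_def)
    moreover have "restrict (lookup ?m) I = g"
        using g lookup by (auto simp: fun_eq_iff PiE_def extensional_def)
    ultimately show "g \<in> (\<lambda>m. restrict (lookup m) I) ` exponents_below I N"
      by (intro image_eqI[of _ _ ?m]) simp_all
  qed (auto simp: exponents_below_def)
qed

lemma card_exponents_below:
  assumes "finite I"
  shows "card (exponents_below I N) = N ^ card I" and "finite (exponents_below I N)"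
proof -
  note bij = bij_betw_exponents_below[OF assms, of N]
  show "finite (exponents_below I N)"
    using bij_betw_finite[OF bij] assms by (simp add: finite_PiE)
  show "card (exponents_below I N) = N ^ card I"
    using bij_betw_same_card[OF bij] assms by (simp add: card_PiE)
qed

locale weighted_forms =
  fixes I :: "'v::countable set" and a :: "'v \<Rightarrow> nat"
    and A :: "'j set" and d :: "'j \<Rightarrow> nat" and F :: "'j \<Rightarrow> 'v cpoly"
  assumes fin: "finite I" "finite A" and a_pos: "\<And>i. i \<in> I \<Longrightarrow> a i > 0"
    and d_pos: "\<And>j. j \<in> A \<Longrightarrow> d j > 0"
    and forms: "\<And>j m. j \<in> A \<Longrightarrow> m \<in> keys (F j) \<Longrightarrow>
      keys m \<subseteq> I \<and> (\<Sum>i\<in>I. a i * lookup m i) = d j"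
begin

section \<open>Counting argument for an ideal of few forms\<close>

definition wdeg :: "('v \<Rightarrow>\<^sub>0 nat) \<Rightarrow> nat" where
  "wdeg m = (\<Sum>i\<in>I. a i * lookup m i)"

lemma wdeg_add: "wdeg (m + m') = wdeg m + wdeg m'"
  by (simp add: wdeg_def lookup_add distrib_left sum.distrib)

text \<open>If the \<open>N\<close>-th powers of the variables lie in the ideal of the forms, the
  monomials with exponents below \<open>N\<close> generate the ring in these variables as a module
  over the subalgebra of the forms. This is that family with the exponents of the forms cut off at
  \<open>D\<close>.\<close>

definition gens :: "nat \<Rightarrow> nat \<Rightarrow> 'v cpoly set" where
  "gens N D = (\<lambda>(b, g). single b 1 * (\<Prod>j\<in>A. F j ^ g j)) ` (exponents_below I N \<times> (A \<rightarrow>\<^sub>E {..D}))"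

lemma gensI:
  "b \<in> exponents_below I N \<Longrightarrow> g \<in> A \<rightarrow>\<^sub>E {..D} \<Longrightarrow> single b 1 * (\<Prod>j\<in>A. F j ^ g j) \<in> gens N D"
  unfolding gens_def by (rule image_eqI[where x = "(b, g)"]) simp_all

lemma gens_mono: "D \<le> D' \<Longrightarrow> gens N D \<subseteq> gens N D'"
  unfolding gens_def by (intro image_mono Sigma_mono PiE_mono) auto

lemma card_gens: "card (gens N D) \<le> N ^ card I * (D + 1) ^ card A"
    and finite_gens: "finite (gens N D)"
proof -
  have "card (gens N D) \<le> card (exponents_below I N \<times> (A \<rightarrow>\<^sub>E {..D}))"
    unfolding gens_def using fin
        by (intro card_image_le finite_cartesian_product finite_PiE card_exponents_below) auto
  then show "card (gens N D) \<le> N ^ card I * (D + 1) ^ card A"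
    using fin by (simp add: card_cartesian_product card_exponents_below card_PiE)
  show "finite (gens N D)"
    unfolding gens_def using fin
        by (intro finite_imageI finite_cartesian_product finite_PiE card_exponents_below) auto
qed

lemma span_gens_mult_form:
  assumes j: "j \<in> A" and p: "p \<in> cpoly_space.span (gens N D)"
  shows "p * F j \<in> cpoly_space.span (gens N (D + 1))"
  using p
proof (induction rule: cpoly_space.span_induct_alt)
  case base
  then show ?case by (simp add: cpoly_space.span_zero)
next
  case (step c x y)
  then obtain b g where bg: "b \<in> exponents_below I N" "g \<in> A \<rightarrow>\<^sub>E {..D}"
    "x = single b 1 * (\<Prod>j\<in>A. F j ^ g j)"
    by (auto simp: gens_def)
  let ?g = "g(j := Suc (g j))"
  have "(\<Prod>k\<in>A. F k ^ ?g k) = F j * F j ^ g j * (\<Prod>k\<in>A - {j}. F k ^ g k)"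
    using j fin by (subst prod.remove[of A j]) auto
  also have "\<dots> = F j * (\<Prod>k\<in>A. F k ^ g k)"
    using j fin by (subst prod.remove[of A j]) (auto simp: mult.assoc)
  finally have "x * F j = single b 1 * (\<Prod>k\<in>A. F k ^ ?g k)"
    by (simp add: bg(3) ac_simps)
  moreover have "?g \<in> A \<rightarrow>\<^sub>E {..D + 1}"
      using bg(2) j by (auto simp: PiE_iff extensional_def le_Suc_eq)
  ultimately have "x * F j \<in> gens N (D + 1)" using gensI[OF bg(1), of ?g "D + 1"] by metis
  then have "single 0 c * (x * F j) + y * F j \<in> cpoly_space.span (gens N (D + 1))"
    by (intro cpoly_space.span_add cpoly_space.span_scale cpoly_space.span_base step)
  then show ?case by (simp add: algebra_simps)
qed

text \<open>A monomial outside \<open>exponents_below I N\<close> is a multiple of some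
  \<open>cvar v ^ N\<close>, hence a combination of forms with coefficients of smaller degree, to
  which induction applies. Forms have positive degree, so at most \<open>wdeg m\<close> factors are
  split off.\<close>

lemma monomial_in_span_gens:
  assumes N: "\<And>v. v \<in> I \<Longrightarrow> cvar v ^ N \<in> ring_ideal.span (F ` A)" and m: "keys m \<subseteq> I"
  shows "single m 1 \<in> cpoly_space.span (gens N (wdeg m))"
  using m
proof (induction "wdeg m" arbitrary: m rule: less_induct)
  case less
  show ?case
  proof (cases "\<forall>i\<in>I. lookup m i < N")
    case True
    \<comment> \<open>All forms get exponent 0; the value \<open>undefined\<close> off
      \<open>A\<close> makes the function extensional.\<close>
    let ?g = "\<lambda>j. if j \<in> A then 0 else undefined :: nat"
    have "m \<in> exponents_below I N" using True less.prems by (simp add: exponents_below_def)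
    moreover have "?g \<in> A \<rightarrow>\<^sub>E {..wdeg m}" by auto
    ultimately have "single m 1 * (\<Prod>j\<in>A. F j ^ ?g j) \<in> gens N (wdeg m)" by (rule gensI)
    then have "single m 1 \<in> gens N (wdeg m)" by simp
    then show ?thesis by (rule cpoly_space.span_base)
  next
    case False
    then obtain v where v: "v \<in> I" "N \<le> lookup m v" by (auto simp: not_less)
    obtain q where q: "cvar v ^ N = (\<Sum>j\<in>A. q j * F j)"
      by (rule in_ideal_span_image[OF fin(2) N[OF v(1)]])
    define m' where "m' = m - single v N"
    have m': "m = m' + single v N"
      using v(2) by (intro poly_mapping_eqI) (auto simp: m'_def lookup_add lookup_minus lookup_single when_def)
    have pow: "cvar v ^ n = single (single v n) (1::complex)" for n
      by (induction n) (simp_all add: mult_single flip: single_add)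
    \<comment> \<open>Taking components of degree \<open>wdeg m\<close> in the variables
      \<open>I\<close> keeps \<open>m\<close> and removes from the coefficients all monomials out of
      reach of the induction. The degree condition is additive to avoid truncated
      subtraction.\<close>
    let ?P = "\<lambda>k. keys k \<subseteq> I \<and> wdeg k = wdeg m"
    let ?Q = "\<lambda>j k. keys k \<subseteq> I \<and> wdeg k + d j = wdeg m"
    let ?p = "\<lambda>j. poly_filter (?Q j) (single m' 1 * q j)"
    have "single m (1::complex) = single m' 1 * cvar v ^ N"
      unfolding pow by (simp add: m' mult_single)
    also have "\<dots> = (\<Sum>j\<in>A. single m' 1 * q j * F j)"
      unfolding q sum_distrib_left mult.assoc ..
    finally have "poly_filter ?P (single m (1::complex))
        = (\<Sum>j\<in>A. poly_filter ?P (single m' 1 * q j * F j))"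
      by (simp add: poly_filter_sum)
    also have "\<dots> = (\<Sum>j\<in>A. ?p j * F j)"
      by (intro sum.cong refl poly_filter_mult)
        (auto simp: keys_add_nat wdeg_add dest: forms[folded wdeg_def])
    finally have eq: "single m (1::complex) = (\<Sum>j\<in>A. ?p j * F j)"
      using less.prems by (simp add: poly_filter_single)
    have "?p j * F j \<in> cpoly_space.span (gens N (wdeg m))" if j: "j \<in> A" for j
    proof (cases "?p j = 0")
      case True
      then show ?thesis by (simp add: cpoly_space.span_zero)
    next
      case False
      have mon: "single k c \<in> cpoly_space.span (gens N (wdeg m - 1))" if "?Q j k" for k c
      proof -
        have "wdeg k < wdeg m" "wdeg k \<le> wdeg m - 1" using that d_pos[OF j] by auto
        then have "single k 1 \<in> cpoly_space.span (gens N (wdeg m - 1))"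
          using less.hyps[of k] that cpoly_space.span_mono[OF gens_mono[of "wdeg k" "wdeg m - 1" N]] by blast
        from cpoly_space.span_scale[OF this, of c] show ?thesis by (simp add: mult_single)
      qed
      have "(\<Sum>k\<in>keys (?p j). single k (lookup (?p j) k)) \<in> cpoly_space.span (gens N (wdeg m - 1))"
        by (intro cpoly_space.span_sum mon) (auto simp: keys_poly_filter)
      then have "?p j * F j \<in> cpoly_space.span (gens N (wdeg m - 1 + 1))"
        unfolding poly_mapping_sum_single by (rule span_gens_mult_form[OF j])
      \<comment> \<open>Ensures that \<open>wdeg m - 1 + 1\<close> is \<open>wdeg m\<close> despite
        truncation.\<close>
      moreover have "wdeg m > 0"
      proof -
        have "\<exists>k. k \<in> keys (?p j)" using False unfolding ex_in_conv keys_eq_empty .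
        then obtain k where "k \<in> keys (?p j)" by (rule exE)
        then have "wdeg k + d j = wdeg m" by (simp add: keys_poly_filter)
        with d_pos[OF j] show ?thesis by linarith
      qed
      ultimately show ?thesis by simp
    qed
    then show ?thesis unfolding eq by (intro cpoly_space.span_sum)
  qed
qed

lemma not_all_powers_in_ideal:
  assumes card: "card A < card I"
  shows "\<exists>v\<in>I. \<forall>N. cvar v ^ N \<notin> ring_ideal.span (F ` A)"
proof (rule ccontr)
  assume "\<not> ?thesis"
  then obtain n where n: "\<And>v. v \<in> I \<Longrightarrow> cvar v ^ n v \<in> ring_ideal.span (F ` A)" by metis
  \<comment> \<open>A common exponent for all variables, since larger powers stay in the
    ideal.\<close>
  define N where "N = (\<Sum>v\<in>I. n v)"
  have N: "cvar v ^ N \<in> ring_ideal.span (F ` A)" if "v \<in> I" for v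
  proof -
    have "n v \<le> N" unfolding N_def using fin that by (intro member_le_sum) auto
    then have "cvar v ^ N = cvar v ^ (N - n v) * (cvar v ^ n v :: 'v cpoly)"
      by (metis le_add_diff_inverse2 power_add)
    with n[OF that] show ?thesis by (simp add: ring_ideal.span_scale)
  qed
  define S where "S = (\<Sum>i\<in>I. a i)"
  \<comment> \<open>Monomials with exponents up to \<open>C\<close> have degree at most
    \<open>S * C\<close>. With this \<open>C\<close> the generators number at most
    \<open>C * (C + 1) ^ card A\<close>, fewer than the \<open>(C + 1) ^ card I\<close>
    monomials.\<close>
  define C where "C = N ^ card I * (S + 1) ^ card A"
  let ?M = "exponents_below I (C + 1)"
  have "wdeg m \<le> S * C" if "m \<in> ?M" for m
    unfolding wdeg_def S_def sum_distrib_right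
    using that by (intro sum_mono mult_left_mono) (auto simp: exponents_below_def less_Suc_eq_le)
  then have "(\<lambda>m. single m 1) ` ?M \<subseteq> cpoly_space.span (gens N (S * C))"
    using monomial_in_span_gens[OF N] cpoly_space.span_mono[OF gens_mono]
    by (fastforce simp: exponents_below_def)
  then have "card ((\<lambda>m. single m (1::complex)) ` ?M) \<le> card (gens N (S * C))"
    using cpoly_space.independent_span_bound[OF finite_gens independent_monomials] by blast
  moreover have "inj_on (\<lambda>m. single m (1::complex)) ?M"
    by (rule inj_onI) (metis keys_single singleton_inject zero_neq_one)
  ultimately have "(C + 1) ^ card I \<le> card (gens N (S * C))"
    by (simp add: card_image card_exponents_below fin)
  also have "\<dots> \<le> N ^ card I * (S * C + 1) ^ card A" by (rule card_gens)
  also have "\<dots> \<le> N ^ card I * ((S + 1) * (C + 1)) ^ card A"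
    by (intro mult_left_mono power_mono) auto
  also have "\<dots> = C * (C + 1) ^ card A" by (simp only: C_def power_mult_distrib mult.assoc)
  also have "\<dots> < (C + 1) ^ Suc (card A)" by simp
  also have "\<dots> \<le> (C + 1) ^ card I" using card by (intro power_increasing) auto
  finally show False by simp
qed

theorem common_zero_of_few_forms:
  assumes "card A < card I"
  shows "\<exists>x. (\<exists>v\<in>I. x v \<noteq> 0) \<and> (\<forall>j\<in>A. eval_poly x (F j) = 0)"
proof -
  obtain v where v: "v \<in> I" "\<And>N. cvar v ^ N \<notin> ring_ideal.span (F ` A)"
    using not_all_powers_in_ideal[OF assms] by blast
  obtain x where "eval_poly x (cvar v) \<noteq> 0" "\<And>f. f \<in> F ` A \<Longrightarrow> eval_poly x f = 0"
    using power_nullstellensatz[OF v(2)] by blast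
  with v(1) show ?thesis by (intro exI[of _ x]) (auto simp: eval_monomial_def)
qed

end

section \<open>The bound on the codimension\<close>

text \<open>Full row rank gives \<open>c\<close> independent columns, whose square submatrix has
  nonzero determinant; some term of its Leibniz expansion is then nonzero.\<close>

lemma full_rank_transversal:
  fixes M :: "complex mat"
  assumes M: "M \<in> carrier_mat c k" and rank: "vec_space.rank c M = c"
  obtains e where "inj_on e {..<c}" "\<And>j. j < c \<Longrightarrow> e j < k" "\<And>j. j < c \<Longrightarrow> M $$ (j, e j) \<noteq> 0"
proof -
  interpret vec_space "TYPE(complex)" c .
  have "lin_indpt {}" by (simp add: lin_dep_def)
  then obtain S where S: "finite S" "maximal S (\<lambda>T. T \<subseteq> set (cols M) \<and> lin_indpt T)"
    using maximal_exists_superset[of "set (cols M)" "\<lambda>T. T \<subseteq> set (cols M) \<and> lin_indpt T" "{}"] by auto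
  then have S_sub: "S \<subseteq> set (cols M)" and S_indpt: "lin_indpt S" by (auto simp: maximal_def)
  have card: "card S = c" using rank_card_indpt[OF M S(2)] rank by simp
  obtain xs where xs: "set xs = S" "distinct xs" using finite_distinct_list[OF S(1)] by blast
  have len: "length xs = c" using xs card distinct_card by metis
  have xs_cols: "xs ! i \<in> set (cols M)" if "i < c" for i
    using that xs S_sub len nth_mem by blast
  have "\<exists>l<k. xs ! i = col M l" if "i < c" for i
    using xs_cols[OF that] M by (auto simp: cols_def)
  then obtain l where l: "\<And>i. i < c \<Longrightarrow> l i < k \<and> xs ! i = col M (l i)" by metis
  have "set xs \<subseteq> carrier_vec c" using xs S_sub M cols_dim by blast
  let ?B = "mat_of_cols c xs"
  have B: "?B \<in> carrier_mat c c" using len by auto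
  have cols: "cols ?B = xs" using \<open>set xs \<subseteq> carrier_vec c\<close> by simp
  have "rank ?B = c"
    by (rule lin_indpt_full_rank[OF B]) (simp_all add: cols xs S_indpt)
  then have "det ?B \<noteq> 0" using det_rank_iff[OF B] by simp
  then obtain p where p: "p permutes {0..<c}" "(\<Prod>i = 0..<c. ?B $$ (i, p i)) \<noteq> 0"
    unfolding det_def'[OF B] by (metis (no_types, lifting) mem_Collect_eq mult_zero_right sum.neutral)
  then have nz: "?B $$ (i, p i) \<noteq> 0" if "i < c" for i using that by auto
  have pc: "p i < c" if "i < c" for i using permutes_in_image[OF p(1), of i] that by simp
  have entry: "?B $$ (i, p i) = M $$ (i, l (p i))" if "i < c" for i
    using that pc[OF that] l[OF pc[OF that]] M len by (simp add: mat_of_cols_index)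
  \<comment> \<open>The chosen columns are distinct vectors, so their indices are distinct.\<close>
  have "inj_on l {..<c}"
    by (rule inj_onI) (metis l len lessThan_iff nth_eq_iff_index_eq xs(2))
  moreover have "inj_on p {..<c}" "p ` {..<c} = {..<c}"
    using permutes_inj_on[OF p(1)] permutes_image[OF p(1)] by (simp_all add: atLeast0LessThan)
  ultimately have "inj_on (l \<circ> p) {..<c}" by (simp add: comp_inj_on)
  then show thesis
    using that[of "l \<circ> p"] l pc nz entry by auto
qed

lemma decreasing_enumeration:
  fixes a :: "nat \<Rightarrow> nat"
  obtains s where "bij_betw s {..<n + 1} {..n}" "\<And>i j. i \<le> j \<Longrightarrow> j < n + 1 \<Longrightarrow> a (s j) \<le> a (s i)"
proof -
  define xs where "xs = rev (sort_key a [0..<n + 1])"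
  have xs: "distinct xs" "length xs = n + 1" "set xs = {..n}" "sorted (rev (map a xs))"
    by (auto simp: xs_def rev_map)
  show thesis
  proof (rule that[of "(!) xs"])
    show "bij_betw ((!) xs) {..<n + 1} {..n}"
      using xs by (intro bij_betw_nth) auto
    show "a (xs ! j) \<le> a (xs ! i)" if "i \<le> j" "j < n + 1" for i j
      using sorted_rev_nth_mono[OF xs(4) that(1)] that xs(2) by simp
  qed
qed

text \<open>Greedy choice: \<open>S (Suc q)\<close> has more elements than the \<open>q\<close>
  chosen before.\<close>

lemma nested_transversal:
  fixes S :: "nat \<Rightarrow> 'a set"
  assumes "\<And>i. i \<le> q \<Longrightarrow> i \<le> card (S i)" and mono: "\<And>i. S i \<subseteq> S (Suc i)"
  shows "\<exists>g. inj_on g {..<q} \<and> (\<forall>i<q. g i \<in> S (Suc i))"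
  using assms(1)
proof (induction q)
  case 0
  then show ?case by simp
next
  case (Suc q)
  then obtain g where g: "inj_on g {..<q}" "\<And>i. i < q \<Longrightarrow> g i \<in> S (Suc i)" by auto
  have "card (g ` {..<q}) < card (S (Suc q))"
    using Suc.prems[of "Suc q"] g(1) by (simp add: card_image)
  then have "\<not> S (Suc q) \<subseteq> g ` {..<q}"
    using card_mono[of "g ` {..<q}" "S (Suc q)"] by auto
  then obtain y where y: "y \<in> S (Suc q)" "y \<notin> g ` {..<q}" by blast
  have "inj_on (g(q := y)) {..<Suc q}"
    using g(1) y(2) by (auto simp: inj_on_def lessThan_Suc)
  moreover have "\<forall>i<Suc q. (g(q := y)) i \<in> S (Suc i)"
    using g(2) y(1) by (auto simp: less_Suc_eq)
  ultimately show ?case by blast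
qed

section \<open>Monomials of the equations and of their derivatives\<close>

lemma keys_diff_subset: "keys (m - m') \<subseteq> keys m" for m :: "'v \<Rightarrow>\<^sub>0 nat"
  by (auto simp: in_keys_iff lookup_minus)

lemma eval_partial_deriv_nonzero:
  assumes "eval_poly x (partial_deriv v f) \<noteq> 0"
  obtains m where "m \<in> keys f" "v \<in> keys m" "\<And>u. u \<in> keys (m - single v 1) \<Longrightarrow> x u \<noteq> 0"
proof -
  from assms obtain m where m: "m \<in> keys f"
    and nz: "of_nat (lookup m v) * lookup f m * eval_monomial x (m - single v 1) \<noteq> 0"
    unfolding partial_deriv_def eval_poly_sum eval_poly_single
    by (rule sum.not_neutral_contains_not_neutral)
  then have "(\<Prod>u\<in>keys (m - single v 1). x u ^ lookup (m - single v 1) u) \<noteq> 0"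
    by (simp add: eval_monomial_def)
  then have "x u \<noteq> 0" if "u \<in> keys (m - single v 1)" for u
    using that by (auto simp: in_keys_iff)
  with m nz show thesis by (intro that[of m]) (auto simp: in_keys_iff)
qed

text \<open>Monomials involving a variable outside \<open>I\<close> vanish at \<open>z\<close>;
  outside \<open>I\<close> the coordinates of \<open>x\<close> are unconstrained.\<close>

lemma eval_poly_coordinate_subspace:
  assumes f: "\<And>m. m \<in> keys f \<Longrightarrow> keys m \<subseteq> V"
    and zero: "\<And>v. v \<in> V - I \<Longrightarrow> z v = 0" and eq: "\<And>v. v \<in> I \<Longrightarrow> z v = x v"
  shows "eval_poly z f = eval_poly x (poly_filter (\<lambda>m. keys m \<subseteq> I) f)"
proof -
  have "eval_monomial z m = (if keys m \<subseteq> I then eval_monomial x m else 0)" if "m \<in> keys f" for m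
  proof (cases "keys m \<subseteq> I")
    case True
    with eq show ?thesis by (auto simp: eval_monomial_def intro!: prod.cong)
  next
    case False
    then obtain v where "v \<in> keys m" "v \<notin> I" by blast
    moreover from this have "z v = 0" using f[OF that] zero by blast
    ultimately have "eval_monomial z m = 0"
      unfolding eval_monomial_def by (intro prod_zero bexI[of _ v]) (auto simp: in_keys_iff)
    with False show ?thesis by simp
  qed
  then have "eval_poly z f = (\<Sum>m\<in>keys f. lookup f m * (if keys m \<subseteq> I then eval_monomial x m else 0))"
    unfolding eval_poly_altdef by (intro sum.cong) auto
  also have "\<dots> = (\<Sum>m\<in>{m \<in> keys f. keys m \<subseteq> I}. lookup f m * eval_monomial x m)"
    by (rule sum.mono_neutral_cong_right) auto
  also have "\<dots> = eval_poly x (poly_filter (\<lambda>m. keys m \<subseteq> I) f)"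
    unfolding eval_poly_altdef keys_poly_filter by (intro sum.cong) (auto simp: lookup_poly_filter)
  finally show ?thesis .
qed

text \<open>If \<open>m\<close> were the single variable \<open>v\<close>, the degree would be the
  weight \<open>a v\<close>. The second variable \<open>w\<close> may coincide with
  \<open>v\<close>.\<close>

lemma whom_two_variables:
  assumes f: "f \<in> whom n a e" "m \<in> keys f" and v: "v \<in> keys m"
    and e: "\<And>i. i \<le> n \<Longrightarrow> e \<noteq> a i"
  obtains w where "w \<in> keys (m - single v 1)" "a v + a w \<le> e"
proof -
  define m' where "m' = m - single v 1"
  have m: "m = single v 1 + m'"
    using v by (intro poly_mapping_eqI)
      (auto simp: m'_def lookup_add lookup_minus lookup_single when_def in_keys_iff)
  from f have keys: "keys m \<subseteq> {..n}" and deg: "(\<Sum>i\<le>n. a i * lookup m i) = e"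
    by (auto simp: whom_def)
  have "v \<le> n" using keys v by auto
  have "(\<Sum>i\<le>n. a i * lookup (single v 1) i) = (\<Sum>i\<le>n. if i = v then a i else 0)"
    by (intro sum.cong) (auto simp: lookup_single when_def)
  also have "\<dots> = a v" using \<open>v \<le> n\<close> by simp
  finally have e_eq: "e = a v + (\<Sum>i\<le>n. a i * lookup m' i)"
    unfolding deg[symmetric] m by (simp add: lookup_add distrib_left sum.distrib)
  have "keys m' \<noteq> {}"
  proof
    assume "keys m' = {}"
    then have "m' = 0" by simp
    with e_eq e[OF \<open>v \<le> n\<close>] show False by simp
  qed
  then obtain w where w: "w \<in> keys m'" by blast
  have "w \<le> n" using w keys keys_diff_subset[of m "single v 1"] by (auto simp: m'_def)
  have "a w * 1 \<le> a w * lookup m' w" using w by (intro mult_left_mono) (auto simp: in_keys_iff)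
  also have "\<dots> \<le> (\<Sum>i\<le>n. a i * lookup m' i)"
    using \<open>w \<le> n\<close> by (intro member_le_sum) auto
  finally show thesis using w e_eq by (intro that[of w]) (auto simp: m'_def)
qed

text \<open>Equations with no monomial in the variables \<open>I\<close> vanish on the coordinate
  subspace, so only the others count; they are truncated to forms in \<open>I\<close>.\<close>

lemma common_zero_on_coordinate_subspace:
  fixes c :: nat
  assumes f: "\<And>j. j < c \<Longrightarrow> f j \<in> whom n a (d j)" and a: "\<And>i. i \<le> n \<Longrightarrow> a i > 0"
    and d: "\<And>j. j < c \<Longrightarrow> d j > 0" and I: "I \<subseteq> {..n}"
    and card: "card {j. j < c \<and> (\<exists>m\<in>keys (f j). keys m \<subseteq> I)} < card I"
  obtains z where "z \<in> punctured_space n" "\<And>i. i \<le> n \<Longrightarrow> i \<notin> I \<Longrightarrow> z $ i = 0"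
    "\<And>j. j < c \<Longrightarrow> eval_poly (($) z) (f j) = 0"
proof -
  let ?R = "{j. j < c \<and> (\<exists>m\<in>keys (f j). keys m \<subseteq> I)}"
  let ?F = "\<lambda>j. poly_filter (\<lambda>m. keys m \<subseteq> I) (f j)"
  interpret weighted_forms I a ?R d ?F
  proof
    fix j m assume j: "j \<in> ?R" and m: "m \<in> keys (?F j)"
    then have "m \<in> keys (f j)" "keys m \<subseteq> I" by (auto simp: keys_poly_filter)
    moreover have "lookup m i = 0" if "i \<notin> I" for i
      using that \<open>keys m \<subseteq> I\<close> by (metis in_keys_iff subsetD)
    then have "(\<Sum>i\<in>I. a i * lookup m i) = (\<Sum>i\<le>n. a i * lookup m i)"
      using I by (intro sum.mono_neutral_left) auto
    ultimately show "keys m \<subseteq> I \<and> (\<Sum>i\<in>I. a i * lookup m i) = d j"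
      using f[of j] j by (auto simp: whom_def)
  next
    show "finite I" using I by (rule finite_subset) simp
    show "finite ?R" by simp
  qed (use I a d in auto)
  obtain x v where v: "v \<in> I" "x v \<noteq> 0" and x: "\<And>j. j \<in> ?R \<Longrightarrow> eval_poly x (?F j) = 0"
    using common_zero_of_few_forms[OF card] by (elim exE conjE bexE) simp
  \<comment> \<open>The zero \<open>x\<close> may have arbitrary coordinates outside
    \<open>I\<close>; they are replaced by 0.\<close>
  define z where "z = vec (n + 1) (\<lambda>i. if i \<in> I then x i else 0)"
  have z: "z $ i = (if i \<in> I then x i else 0)" if "i \<le> n" for i using that by (simp add: z_def)
  show thesis
  proof (rule that[of z])
    have "z $ v \<noteq> 0\<^sub>v (n + 1) $ v" using v I z[of v] by auto
    then show "z \<in> punctured_space n" by (auto simp: punctured_space_def z_def)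
    show "z $ i = 0" if "i \<le> n" "i \<notin> I" for i using z that by simp
    show "eval_poly (($) z) (f j) = 0" if j: "j < c" for j
    proof -
      have "eval_poly (($) z) (f j) = eval_poly x (?F j)"
        using f[OF j] z I
        by (intro eval_poly_coordinate_subspace[where V = "{..n}"]) (auto simp: whom_def)
      moreover have "?F j = 0" if "j \<notin> ?R"
        using that j by (intro poly_mapping_eqI) (auto simp: lookup_poly_filter in_keys_iff)
      ultimately show ?thesis using x[of j] by (cases "j \<in> ?R") auto
    qed
  qed
qed

lemma quasismooth_amplitude_ge:
  fixes c :: nat
  assumes f: "\<And>j. j < c \<Longrightarrow> f j \<in> whom n a (d j)" and a: "\<And>i. i \<le> n \<Longrightarrow> a i > 0"
    and d: "\<And>j. j < c \<Longrightarrow> d j > 0" and cone: "\<And>i j. i \<le> n \<Longrightarrow> j < c \<Longrightarrow> d j \<noteq> a i"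
    and qs: "quasismooth n a c f" and c: "c \<le> n" "n + 1 \<le> 2 * c"
  shows "2 * int c - int n - 1 \<le> amplitude n a c d"
proof -
  obtain s where s: "bij_betw s {..<n + 1} {..n}"
    and dec: "\<And>i j. i \<le> j \<Longrightarrow> j < n + 1 \<Longrightarrow> a (s j) \<le> a (s i)"
    using decreasing_enumeration[of n a] by blast
  have s_inj: "inj_on s {..<n + 1}" and s_img: "s ` {..<n + 1} = {..n}"
    using s by (auto simp: bij_betw_def)
  define I where "I k = s ` {..<k}" for k
  define R where "R k = {j. j < c \<and> (\<exists>m\<in>keys (f j). keys m \<subseteq> I k)}" for k
  have R_mono: "R k \<subseteq> R l" if "k \<le> l" for k l
  proof -
    have "I k \<subseteq> I l" using that by (auto simp: I_def)
    then show ?thesis by (auto simp: R_def)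
  qed
  have R_fin: "finite (R k)" and R_sub: "R k \<subseteq> {..<c}" for k by (auto simp: R_def)
  define k where "k = (LEAST k. card (R k) < k)"
  \<comment> \<open>Guarantees that the least \<open>k\<close> exists, and
    \<open>k \<le> c + 1 \<le> n + 1\<close> keeps \<open>I k\<close> within the variables.\<close>
  have "card (R (c + 1)) < c + 1" using card_mono[OF _ R_sub, of "c + 1"] by simp
  then have k: "card (R k) < k" "k \<le> c + 1"
    unfolding k_def by (auto intro: LeastI Least_le)
  have below: "i \<le> card (R i)" if "i < k" for i
    using not_less_Least[of i "\<lambda>k. card (R k) < k"] that by (simp add: k_def)
  define q where "q = k - 1"
  have kq: "k = Suc q" using k by (simp add: q_def)
  have qc: "q \<le> c" "q \<le> n" using k c kq by auto
  have card_R: "card (R k) = q"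
    \<comment> \<open>Minimality gives \<open>q \<le> card (R q) \<le> card (R k)\<close>, while
      \<open>card (R k) < q + 1\<close>.\<close>
    using below[of q] k kq card_mono[OF R_fin R_mono, of q k] by simp
  have I_sub: "I k \<subseteq> {..n}" unfolding s_img[symmetric] I_def using qc kq by auto
  have I_card: "card (I k) = k"
    unfolding I_def by (subst card_image) (use s_inj qc kq in \<open>auto intro: inj_on_subset\<close>)
  \<comment> \<open>The least weight in \<open>I k\<close>; as weights decrease along
    \<open>s\<close>, it also bounds all weights outside \<open>I k\<close> from above.\<close>
  define B where "B = a (s q)"
  have "s q \<in> s ` {..<n + 1}" using qc by auto
  then have B_pos: "B \<ge> 1" using a[of "s q"] unfolding s_img by (simp add: B_def)
  have ge_B: "B \<le> a v" if "v \<in> I k" for v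
    using that dec[of _ q] qc kq by (auto simp: I_def B_def)
  have le_B: "a v \<le> B" if v: "v \<le> n" "v \<notin> I k" for v
  proof -
    obtain i where i: "v = s i" "i < n + 1"
        using v(1) s_img by (metis atMost_iff imageE lessThan_iff)
    with v have "q \<le> i" by (auto simp: I_def kq less_Suc_eq_le not_le)
    with dec[OF this] i show ?thesis by (simp add: B_def)
  qed

  obtain g where g_inj: "inj_on g {..<q}" and g: "\<And>i. i < q \<Longrightarrow> g i \<in> R (Suc i)"
    using nested_transversal[of q R] below kq R_mono by (metis le_imp_less_Suc lessI less_imp_le)
  have g_img: "g ` {..<q} = R k"
  proof (rule card_subset_eq[OF R_fin])
    show "g ` {..<q} \<subseteq> R k"
    proof (rule image_subsetI)
      fix i assume "i \<in> {..<q}"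
      then show "g i \<in> R k" using g[of i] R_mono[of "Suc i" k] kq by auto
    qed
    show "card (g ` {..<q}) = card (R k)" using g_inj by (simp add: card_image card_R)
  qed
  \<comment> \<open>Some monomial of \<open>g i\<close> uses only the variables \<open>s 0\<close>
    to \<open>s i\<close>, all of weight at least \<open>a (s i)\<close>, and has at least two
    factors.\<close>
  have d_g: "2 * a (s i) \<le> d (g i)" if i: "i < q" for i
  proof -
    from g[OF i] obtain m where j: "g i < c" and m: "m \<in> keys (f (g i))" "keys m \<subseteq> I (Suc i)"
      by (auto simp: R_def)
    have ge: "a (s i) \<le> a v" if "v \<in> I (Suc i)" for v
      using that dec[of _ i] i qc by (auto simp: I_def)
    have "keys m \<noteq> {}"
    proof
      assume "keys m = {}"
      then have "m = 0" by simp
      with f[OF j] m(1) d[OF j] show False by (auto simp: whom_def)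
    qed
    then obtain v where v: "v \<in> keys m" by blast
    obtain w where w: "w \<in> keys (m - single v 1)" "a v + a w \<le> d (g i)"
      using whom_two_variables[OF f[OF j] m(1) v] cone[OF _ j] by blast
    have "w \<in> keys m" using w(1) keys_diff_subset[of m "single v 1"] by blast
    with m(2) v have "a (s i) \<le> a v" "a (s i) \<le> a w" using ge by blast+
    with w(2) show ?thesis by linarith
  qed

  have few: "card {j. j < c \<and> (\<exists>m\<in>keys (f j). keys m \<subseteq> I k)} < card (I k)"
    using k(1) I_card by (simp add: R_def)
  obtain z where z: "z \<in> punctured_space n" "\<And>i. i \<le> n \<Longrightarrow> i \<notin> I k \<Longrightarrow> z $ i = 0"
    "\<And>j. j < c \<Longrightarrow> eval_poly (($) z) (f j) = 0"
    using common_zero_on_coordinate_subspace[OF f a d I_sub few] by blast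
  have "wps_proj n a z \<in> wci_locus n a c f" using z by (auto simp: wci_locus_def)
  with qs z(1) have "vec_space.rank c (jacobian n c f z) = c" by (auto simp: quasismooth_def)
  moreover have "jacobian n c f z \<in> carrier_mat c (n + 1)" by (simp add: jacobian_def)
  ultimately obtain e where e_inj: "inj_on e {..<c}" and e_le: "\<And>j. j < c \<Longrightarrow> e j < n + 1"
    and e_nz: "\<And>j. j < c \<Longrightarrow> jacobian n c f z $$ (j, e j) \<noteq> 0"
    using full_rank_transversal by metis
  define C where "C = {..<c} - R k"
  \<comment> \<open>The nonzero derivative yields a monomial whose quotient by the variable
    \<open>e j\<close> is supported where \<open>z\<close> is nonzero, hence in \<open>I k\<close>.
    As \<open>j\<close> is outside \<open>R k\<close>, the whole monomial is not, so
    \<open>e j\<close> lies outside \<open>I k\<close>.\<close>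
  have C: "e j \<notin> I k \<and> a (e j) + B \<le> d j" if "j \<in> C" for j
  proof -
    have j: "j < c" "j \<notin> R k" using that by (auto simp: C_def)
    have "eval_poly (($) z) (partial_deriv (e j) (f j)) \<noteq> 0"
      using e_nz[OF j(1)] e_le[OF j(1)] j(1) by (simp add: jacobian_def)
    then obtain m where m: "m \<in> keys (f j)" "e j \<in> keys m"
      and nz: "\<And>u. u \<in> keys (m - single (e j) 1) \<Longrightarrow> z $ u \<noteq> 0"
      by (rule eval_partial_deriv_nonzero) blast
    have "keys m \<subseteq> {..n}" using f[OF j(1)] m(1) by (auto simp: whom_def)
    with nz z(2) keys_diff_subset[of m "single (e j) 1"]
    have rest: "keys (m - single (e j) 1) \<subseteq> I k" by blast
    have "keys m \<subseteq> insert (e j) (keys (m - single (e j) 1))"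
      by (auto simp: in_keys_iff lookup_minus lookup_single when_def split: if_splits)
    with rest j m(1) have "e j \<notin> I k" by (auto simp: R_def)
    moreover obtain w where "w \<in> keys (m - single (e j) 1)" "a (e j) + a w \<le> d j"
      using whom_two_variables[OF f[OF j(1)] m] cone[OF _ j(1)] by blast
    ultimately show ?thesis using rest ge_B[of w] by auto
  qed
  have C_card: "card C = c - q"
    unfolding C_def using R_sub R_fin by (subst card_Diff_subset) (auto simp: card_R)
  define E where "E = e ` C"
  \<comment> \<open>The variables neither in \<open>I k\<close> nor hit by \<open>e\<close> on
    \<open>C\<close>: there are \<open>n + 1 - k - (c - q) = n - c\<close> of them.\<close>
  define T where "T = {..n} - I k - E"
  have e_inj_C: "inj_on e C" using e_inj by (rule inj_on_subset) (auto simp: C_def)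
  have E_sub: "E \<subseteq> {..n} - I k" using C e_le by (fastforce simp: E_def C_def)
  have E_card: "card E = c - q" unfolding E_def using e_inj_C C_card by (simp add: card_image)
  have T_card: "card T = n - c"
  proof -
    have "card ({..n} - I k) = n + 1 - k"
      using I_sub I_card by (subst card_Diff_subset) (auto intro: finite_subset)
    then show ?thesis
      unfolding T_def using E_sub E_card kq qc
          by (subst card_Diff_subset) (auto intro: finite_subset)
  qed

  have "(\<Sum>j<c. d j) = (\<Sum>j\<in>R k. d j) + (\<Sum>j\<in>C. d j)"
    unfolding C_def using R_sub by (subst sum.subset_diff[of "R k"]) auto
  also have "(\<Sum>j\<in>R k. d j) = (\<Sum>i<q. d (g i))"
    unfolding g_img[symmetric] using g_inj by (simp add: sum.reindex)
  finally have "(\<Sum>i<q. 2 * a (s i)) + (\<Sum>j\<in>C. a (e j) + B) \<le> (\<Sum>j<c. d j)"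
    using sum_mono[of "{..<q}" "\<lambda>i. 2 * a (s i)" "\<lambda>i. d (g i)"] d_g
      sum_mono[of C "\<lambda>j. a (e j) + B" d] C by fastforce
  moreover have "(\<Sum>j\<in>C. a (e j) + B) = (\<Sum>v\<in>E. a v) + (c - q) * B"
    unfolding E_def using e_inj_C C_card by (simp add: sum.reindex sum.distrib)
  ultimately have deg: "2 * (\<Sum>i<q. a (s i)) + (\<Sum>v\<in>E. a v) + (c - q) * B \<le> (\<Sum>j<c. d j)"
    by (simp add: sum_distrib_left)
  have "(\<Sum>i\<le>n. a i) = (\<Sum>v\<in>{..n} - I k. a v) + (\<Sum>v\<in>I k. a v)"
    using I_sub by (intro sum.subset_diff) auto
  also have "(\<Sum>v\<in>{..n} - I k. a v) = (\<Sum>v\<in>T. a v) + (\<Sum>v\<in>E. a v)"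
    unfolding T_def using E_sub by (intro sum.subset_diff) auto
  also have "(\<Sum>v\<in>I k. a v) = (\<Sum>i<q. a (s i)) + B"
  proof -
    have "inj_on s {..<k}" using s_inj by (rule inj_on_subset) (use qc kq in auto)
    then show ?thesis by (simp add: I_def sum.reindex kq B_def)
  qed
  finally have wts: "(\<Sum>i\<le>n. a i) \<le> (n - c) * B + (\<Sum>v\<in>E. a v) + (\<Sum>i<q. a (s i)) + B"
    using sum_bounded_above[of T a B] le_B T_card by (simp add: T_def)
  have low: "q * B \<le> (\<Sum>i<q. a (s i))"
    using sum_bounded_below[of "{..<q}" B "\<lambda>i. a (s i)"] ge_B by (simp add: I_def kq)
  have diffs: "int c * int B - int (q * B) = int ((c - q) * B)"
      "int n * int B - int c * int B = int ((n - c) * B)"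
    using qc c by (simp_all add: of_nat_diff left_diff_distrib)
  \<comment> \<open>The products with \<open>B\<close> become atoms: \<open>u\<close>,
    \<open>v\<close>, \<open>l\<close>, \<open>p\<close>, \<open>r\<close> stand for
    \<open>B\<close> times \<open>c\<close>, \<open>n\<close>, \<open>q\<close>,
    \<open>c - q\<close>, \<open>n - c\<close>, and \<open>b\<close> for \<open>B\<close>. The
    weights of \<open>E\<close> cancel.\<close>
  have arith: "2 * u - v - int b \<le> int t - int w"
    if "2 * x + y + p \<le> t" "w \<le> r + y + x + b" "l \<le> x" "u - int l = int p" "v - u = int r"
    for x y p t w r b l :: nat and u v :: int
    using that by linarith
  have "2 * (int c * int B) - int n * int B - int B \<le> int (\<Sum>j<c. d j) - int (\<Sum>i\<le>n. a i)"
    by (rule arith[OF deg wts low diffs])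
  then have "2 * (int c * int B) - int n * int B - int B \<le> amplitude n a c d"
    by (simp add: amplitude_def)
  \<comment> \<open>The factor is nonnegative because \<open>n + 1 \<le> 2 * c\<close>, so
    \<open>B\<close> can be replaced by 1.\<close>
  moreover have "(2 * int c - int n - 1) * 1 \<le> (2 * int c - int n - 1) * int B"
    using c B_pos by (intro mult_left_mono) auto
  ultimately show ?thesis by (simp add: algebra_simps)
qed


section \<open>From one quasismooth system to the bound for general equations\<close>

theorem theorem1p3:
  fixes n c :: nat and a d :: "nat \<Rightarrow> nat" and dimX \<alpha> :: int
  assumes weights_pos: "\<And>i. i \<le> n \<Longrightarrow> a i > 0"
    and well_formed: "well_formed n a"
    and degrees_pos: "\<And>j. j < c \<Longrightarrow> d j > 0"
    and quasismooth: "for_general_equations n a c d (quasismooth_wci n a c)"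
    and not_linear_cone: "\<And>i j. i \<le> n \<Longrightarrow> j < c \<Longrightarrow> d j \<noteq> a i"
    and dimX: "dimX = int n - int c"
    and amplitude: "\<alpha> = amplitude n a c d"
  shows "int c \<le> (if \<alpha> \<ge> 0 then dimX + \<alpha> + 1 else dimX)"
proof -
  obtain U where U: "openin (zariski_equations n a c d) U" "U \<noteq> {}"
    and "\<forall>f\<in>U. quasismooth_wci n a c f"
    using quasismooth unfolding for_general_equations_def by (elim exE conjE)
  then obtain f where "f \<in> U" "quasismooth_wci n a c f" by blast
  then have qs: "quasismooth n a c f" and "c \<le> n"
    by (auto simp: quasismooth_wci_def has_codim_def)
  have "f \<in> wci_equations n a c d"
    using openin_subset[OF U(1)] \<open>f \<in> U\<close> by (auto simp: topspace_zariski_equations)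
  then have f: "f j \<in> whom n a (d j)" if "j < c" for j
    using that by (auto simp: wci_equations_def)
  show ?thesis
  proof (cases "n + 1 \<le> 2 * c")
    case True
    \<comment> \<open>Here this bound forces \<open>\<alpha> \<ge> 0\<close>, so only the first
      branch of the conclusion occurs.\<close>
    have "2 * int c - int n - 1 \<le> \<alpha>"
      unfolding amplitude
      using quasismooth_amplitude_ge[OF f weights_pos degrees_pos not_linear_cone qs \<open>c \<le> n\<close> True]
      by simp
    with True dimX show ?thesis by auto
  next
    case False
    with dimX show ?thesis by auto
  qed
qed

end
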